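(* Let $N\ge 1$, $\mathcal H=(\mathbb C^2)^{\otimes N}$, $\mathbf J=\sum_{i=1}^N\hat\sigma_{i-}$, $\lambda>0$, and $\mathbf H_S=\sum_{\alpha,\beta=1}^N b_{\alpha\beta}\,\hat\sigma_{\alpha+}\hat\sigma_{\beta-}$ with $(b_{\alpha\beta})$ a Hermitian $N\times N$ matrix. Let $V=\{v\in\mathcal H:\mathbf J v=0\}$ be the subspace of lowest weight vectors, and let $W\subseteq V$ be a linear subspace. Then $W$ is completely decoherence-free (for the master equation determined by $\mathbf H_S$, $\mathbf J$ and $\lambda$) if and only if $\mathbf H_S W\subseteq W$. In particular, in that case $\mathbf H_S$ can be diagonalized in $W$, i.e. $W$ has a basis consisting of eigenvectors of $\mathbf H_S$.
   Context: Each qubit $\mathbb C^2$ has orthonormal basis $|0\rangle$ (ground), $|1\rangle$ (excited). $\hat\sigma_-=|0\rangle\langle 1|$, $\hat\sigma_+=|1\rangle\langle 0|$, and $\hat\sigma_{i\pm}$ denotes $\hat\sigma_\pm$ acting on the $i$-th tensor factor of $\mathcal H$ and as the identity on the others. The density operator $\rho(t)$ on $\mathcal H$ obeys the Markovian master equation $$\dot\rho=-i[\mathbf H_S,\rho]+\mathrm L_{\mathrm D}[\rho],\qquad \mathrm L_{\mathrm D}[\rho]=\lambda\left(2\mathbf J\rho\mathbf J^\dagger-\mathbf J^\dagger\mathbf J\rho-\rho\mathbf J^\dagger\mathbf J\right).$$ A linear subspace $W\subseteq\mathcal H$ is called completely decoherence-free (CDF) if (1) $\mathrm L_{\mathrm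 D}[\rho]=0$ for every density operator $\rho$ supported on $W$ (written $\mathrm L_{\mathrm D}[W]=0$), and (2) whenever $\rho(0)$ is a density operator supported on $W$, the solution $\rho(t)$ of the master equation is supported on $W$ for all $t\ge 0$ (written $\rho(t)\in W$ for all $t$). A density operator is supported on $W$ if its range is contained in $W$. *)

theory Defs
  imports "HOL-Analysis.Analysis"
begin

section \<open>Operators on finite-dimensional complex coordinate spaces\<close>

definition dagger :: "complex^'m^'n \<Rightarrow> complex^'n^'m" where
  "dagger A = (\<chi> i j. cnj (A $ j $ i))"

definition hermitian :: "complex^'n^'n \<Rightarrow> bool" where
  "hermitian A \<longleftrightarrow> dagger A = A"

text \<open>Library products \<^term>\<open>inner\<close> on complex coordinate spaces are real-valued; this is the
  sesquilinear product, antilinear in the first argument.\<close>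
definition cinner :: "complex^'n \<Rightarrow> complex^'n \<Rightarrow> complex" where
  "cinner v w = (\<Sum>i\<in>UNIV. cnj (v $ i) * w $ i)"

definition outer :: "complex^'m \<Rightarrow> complex^'n \<Rightarrow> complex^'n^'m" where
  "outer v w = (\<chi> i j. v $ i * cnj (w $ j))"

definition eigenvector :: "complex^'n^'n \<Rightarrow> complex^'n \<Rightarrow> bool" where
  "eigenvector A v \<longleftrightarrow> v \<noteq> 0 \<and> (\<exists>c. A *v v = c *s v)"

definition density_operator :: "complex^'n^'n \<Rightarrow> bool" where
  "density_operator \<rho> \<longleftrightarrow>
     hermitian \<rho> \<and> (\<forall>v. 0 \<le> Re (cinner v (\<rho> *v v))) \<and> trace \<rho> = 1"

definition supported_on :: "complex^'n^'n \<Rightarrow> (complex^'n) set \<Rightarrow> bool" where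
  "supported_on \<rho> W \<longleftrightarrow> range ((*v) \<rho>) \<subseteq> W"


section \<open>Markovian master equation and complete decoherence-freeness\<close>

definition commutator :: "complex^'n^'n \<Rightarrow> complex^'n^'n \<Rightarrow> complex^'n^'n" where
  "commutator A B = A ** B - B ** A"

definition dissipator ::
  "real \<Rightarrow> complex^'n^'n \<Rightarrow> complex^'n^'n \<Rightarrow> complex^'n^'n" where
  "dissipator lam J \<rho> = lam *\<^sub>R
     (2 *\<^sub>R (J ** \<rho> ** dagger J) - dagger J ** J ** \<rho> - \<rho> ** dagger J ** J)"

text \<open>A complex number \<open>c\<close> acts on square matrices as multiplication by the scalar
  matrix \<^term>\<open>mat c\<close>.\<close>
definition master_generator ::
  "complex^'n^'n \<Rightarrow> complex^'n^'n \<Rightarrow> real \<Rightarrow> complex^'n^'n \<Rightarrow> complex^'n^'n" where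
  "master_generator H J lam \<rho> = mat (- \<i>) ** commutator H \<rho> + dissipator lam J \<rho>"

definition master_solution ::
  "complex^'n^'n \<Rightarrow> complex^'n^'n \<Rightarrow> real \<Rightarrow> (real \<Rightarrow> complex^'n^'n) \<Rightarrow> bool" where
  "master_solution H J lam \<rho> \<longleftrightarrow>
     (\<forall>t\<ge>0. (\<rho> has_vector_derivative master_generator H J lam (\<rho> t)) (at t within {0..}))"

text \<open>The master equation is a linear equation with constant coefficients in finite dimension, so
  every initial value has exactly one solution on \<open>[0, \<infinity>)\<close>; quantifying over all solutions with a
  given initial value therefore speaks about that unique solution.\<close>
definition completely_decoherence_free ::
  "complex^'n^'n \<Rightarrow> complex^'n^'n \<Rightarrow> real \<Rightarrow> (complex^'n) set \<Rightarrow> bool" where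
  "completely_decoherence_free H J lam W \<longleftrightarrow>
     (\<forall>\<rho>. density_operator \<rho> \<longrightarrow> supported_on \<rho> W \<longrightarrow> dissipator lam J \<rho> = 0) \<and>
     (\<forall>\<rho>. master_solution H J lam \<rho> \<longrightarrow> density_operator (\<rho> 0) \<longrightarrow> supported_on (\<rho> 0) W \<longrightarrow>
        (\<forall>t\<ge>0. supported_on (\<rho> t) W))"


section \<open>Qubits and their tensor products\<close>

text \<open>The qubit basis is indexed by \<^typ>\<open>bool\<close>, with \<^term>\<open>False\<close> for the ground state and
  \<^term>\<open>True\<close> for the excited state.\<close>
type_synonym qubit = "complex^bool"

definition ket :: "bool \<Rightarrow> qubit" where
  "ket s = axis s 1"

definition sigma_minus :: "complex^bool^bool" where
  "sigma_minus = outer (ket False) (ket True)"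

definition sigma_plus :: "complex^bool^bool" where
  "sigma_plus = outer (ket True) (ket False)"

text \<open>The tensor product of qubits labelled by the finite type \<^typ>\<open>'n\<close> (so \<open>N = CARD('n)\<close>) is
  given in its product basis: the coordinate at \<open>s :: 'n \<Rightarrow> bool\<close> belongs to the tensor product
  of the kets \<open>ket (s i)\<close>.\<close>
type_synonym 'n qubits = "complex^('n \<Rightarrow> bool)"
type_synonym 'n qubits_op = "complex^('n \<Rightarrow> bool)^('n \<Rightarrow> bool)"

definition tensor_vec :: "('n::finite \<Rightarrow> qubit) \<Rightarrow> 'n qubits" where
  "tensor_vec v = (\<chi> s. \<Prod>i\<in>UNIV. v i $ s i)"

definition tensor_op :: "('n::finite \<Rightarrow> complex^bool^bool) \<Rightarrow> 'n qubits_op" where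
  "tensor_op A = (\<chi> s t. \<Prod>i\<in>UNIV. A i $ s i $ t i)"

lemma tensor_vec_ket: "tensor_vec (\<lambda>i. ket (s i)) = axis s 1"
proof (unfold vec_eq_iff, rule allI)
  fix t
  show "tensor_vec (\<lambda>i. ket (s i)) $ t = axis s 1 $ t"
  proof (cases "t = s")
    case True
    then show ?thesis by (simp add: tensor_vec_def ket_def)
  next
    case False
    then obtain i where "t i \<noteq> s i" by blast
    then show ?thesis using False
      by (auto simp: tensor_vec_def ket_def axis_def intro!: prod_zero)
  qed
qed

lemma tensor_op_tensor_vec: "tensor_op A *v tensor_vec v = tensor_vec (\<lambda>i. A i *v v i)"
proof (unfold vec_eq_iff, rule allI)
  fix s
  have "(\<Prod>i\<in>UNIV. \<Sum>b\<in>UNIV. A i $ s i $ b * v i $ b)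
      = (\<Sum>t\<in>PiE UNIV (\<lambda>_. UNIV). \<Prod>i\<in>UNIV. A i $ s i $ t i * v i $ t i)"
    by (rule prod_sum_PiE) auto
  then show "(tensor_op A *v tensor_vec v) $ s = tensor_vec (\<lambda>i. A i *v v i) $ s"
    by (simp add: tensor_op_def tensor_vec_def matrix_vector_mult_def prod.distrib)
qed

definition on_site :: "'n::finite \<Rightarrow> complex^bool^bool \<Rightarrow> 'n qubits_op" where
  "on_site i A = tensor_op (\<lambda>j. if j = i then A else mat 1)"

definition collective_lowering :: "'n::finite qubits_op" where
  "collective_lowering = (\<Sum>i\<in>UNIV. on_site i sigma_minus)"

definition exchange_hamiltonian :: "complex^'n^'n \<Rightarrow> 'n::finite qubits_op" where
  "exchange_hamiltonian b =
     (\<Sum>\<alpha>\<in>UNIV. \<Sum>\<beta>\<in>UNIV.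
        mat (b $ \<alpha> $ \<beta>) ** (on_site \<alpha> sigma_plus ** on_site \<beta> sigma_minus))"

definition lowest_weight_space :: "'n::finite qubits set" where
  "lowest_weight_space = {v. collective_lowering *v v = 0}"

end

theory Submission
  imports Defs
begin

text \<open>
  If \<open>H\<close> leaves \<open>W\<close> invariant, then the generator leaves invariant the real space of Hermitian matrices
  supported on \<open>W\<close>, since the dissipator vanishes there; a solution that starts in an invariant
  subspace of a linear equation stays in it. Conversely, the derivative at \<open>t = 0\<close> of the solution
  starting from the pure state \<open>|w><w|\<close> is \<open>-i [H, |w><w|]\<close>, and it is supported on \<open>W\<close>; applied to
  \<open>w\<close> it gives \<open>H w - <w, H w> w \<in> W\<close>. The eigenbasis is the spectral theorem for the Hermitian \<open>H\<close>
  restricted to \<open>W\<close>.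
\<close>

section \<open>Spectral theorem for self-adjoint maps on invariant subspaces\<close>

text \<open>A maximiser \<open>v\<close> of the Rayleigh quotient is a zero of the nonnegative quadratic form
  \<open>r x = \<mu> (x \<bullet> x) - x \<bullet> f x\<close>; perturbing \<open>v\<close> in the direction \<open>w = \<mu> v - f v\<close> forces \<open>w = 0\<close>.\<close>
lemma self_adjoint_eigenvector_exists:
  fixes f :: "'a::euclidean_space \<Rightarrow> 'a"
  assumes f: "linear f" and sa: "\<And>x y. x \<bullet> f y = f x \<bullet> y"
    and S: "subspace S" and inv: "f ` S \<subseteq> S" and nz: "S \<noteq> {0}"
  obtains v c where "v \<in> S" "v \<noteq> 0" "f v = c *\<^sub>R v"
proof -
  interpret f: linear f by fact
  define K where "K = S \<inter> sphere 0 1"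
  obtain z where z: "z \<in> S" "z \<noteq> 0"
    using nz subspace_0[OF S] by blast
  have "z /\<^sub>R norm z \<in> K"
    using z subspace_scale[OF S] by (simp add: K_def)
  moreover have "compact K"
    using closed_subspace[OF S] compact_sphere unfolding K_def by (metis closed_Int_compact)
  moreover have "continuous_on K (\<lambda>x. x \<bullet> f x)"
    by (intro continuous_intros linear_continuous_on linear_conv_bounded_linear[THEN iffD1] f)
  ultimately obtain v where v: "v \<in> K" and vmax: "\<And>x. x \<in> K \<Longrightarrow> x \<bullet> f x \<le> v \<bullet> f v"
    using continuous_attains_sup[of K "\<lambda>x. x \<bullet> f x"] by blast
  define \<mu> where "\<mu> = v \<bullet> f v"
  define r where "r x = \<mu> * (x \<bullet> x) - x \<bullet> f x" for x
  have r_nonneg: "r x \<ge> 0" if x: "x \<in> S" for x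
  proof (cases "x = 0")
    case False
    have "x /\<^sub>R norm x \<in> K"
      using x False subspace_scale[OF S] by (simp add: K_def)
    from vmax[OF this] have "(x \<bullet> f x) / (norm x)\<^sup>2 \<le> \<mu>"
      by (simp add: f.scaleR \<mu>_def power2_eq_square field_simps)
    then show ?thesis
      using False by (simp add: r_def field_simps power2_norm_eq_inner)
  qed (simp add: r_def)
  define w where "w = \<mu> *\<^sub>R v - f v"
  have vS: "v \<in> S" and vv: "v \<bullet> v = 1"
    using v by (auto simp: K_def norm_eq_1)
  have wS: "w \<in> S"
    using vS inv subspace_diff[OF S] subspace_scale[OF S] unfolding w_def by blast
  \<comment> \<open>The constant term is \<open>r v = 0\<close>, since \<open>v\<close> is a unit
    vector and \<mu> is its Rayleigh quotient. The linear coefficient is twice the inner product of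
    \<open>w\<close> with \<mu>\<open>v - f v\<close>, which is \<open>w\<close> itself.\<close>
  have expand: "r (v + t *\<^sub>R w) = 2 * t * (w \<bullet> w) + t\<^sup>2 * r w" for t
  proof -
    have "w \<bullet> w = \<mu> * (w \<bullet> v) - w \<bullet> f v"
      by (subst (2) w_def) (simp add: inner_diff_right)
    moreover have "v \<bullet> f w = w \<bullet> f v"
      using sa[of v w] by (simp add: inner_commute)
    then have "r (v + t *\<^sub>R w) = 2 * t * (\<mu> * (w \<bullet> v) - w \<bullet> f v) + t\<^sup>2 * r w"
      by (simp add: r_def f.add f.scaleR vv \<mu>_def
          inner_commute[of v w] power2_eq_square algebra_simps)
    ultimately show ?thesis by simp
  qed
  have "w \<bullet> w = 0"
  proof (rule ccontr)
    assume "w \<bullet> w \<noteq> 0"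
    then have pos: "w \<bullet> w > 0" by simp
    \<comment> \<open>The \<open>+ 1\<close> keeps the denominator positive when
      \<open>r w = 0\<close> and gives \<open>- (t * r w)\<close> at most the squared norm of
      \<open>w\<close>, so the linear term dominates and \<open>r\<close> would be negative.\<close>
    define t where "t = - (w \<bullet> w) / (r w + 1)"
    have rw: "r w \<ge> 0" using r_nonneg wS .
    have "t < 0" using pos rw by (simp add: t_def divide_neg_pos)
    have "0 \<le> t * (2 * (w \<bullet> w) + t * r w)"
      using r_nonneg[of "v + t *\<^sub>R w"] expand[of t] vS wS subspace_add[OF S] subspace_scale[OF S]
      by (simp add: power2_eq_square algebra_simps)
    then have "2 * (w \<bullet> w) + t * r w \<le> 0"
      using \<open>t < 0\<close> by (simp add: zero_le_mult_iff)
    moreover have "- (t * r w) \<le> w \<bullet> w"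
      using pos rw by (simp add: t_def field_simps)
    ultimately show False using pos by linarith
  qed
  then have "f v = \<mu> *\<^sub>R v" by (simp add: w_def)
  moreover have "v \<noteq> 0" using vv by auto
  ultimately show ?thesis using that vS by blast
qed

text \<open>By self-adjointness the vectors of \<open>S\<close> orthogonal to all eigenvectors in
  \<open>S\<close> again form an invariant subspace. If it were nonzero it would contain an
  eigenvector, which would be orthogonal to itself.\<close>

lemma self_adjoint_span_eigenvectors:
  fixes f :: "'a::euclidean_space \<Rightarrow> 'a"
  assumes f: "linear f" and sa: "\<And>x y. x \<bullet> f y = f x \<bullet> y"
    and S: "subspace S" and inv: "f ` S \<subseteq> S"
  shows "span {v \<in> S. v \<noteq> 0 \<and> (\<exists>c. f v = c *\<^sub>R v)} = S"
proof (rule ccontr)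
  interpret f: linear f by fact
  let ?E = "{v \<in> S. v \<noteq> 0 \<and> (\<exists>c. f v = c *\<^sub>R v)}"
  assume "span ?E \<noteq> S"
  moreover have "span ?E \<subseteq> S"
    using S by (intro span_minimal) auto
  ultimately have "span ?E \<subset> span S"
    unfolding span_eq_iff[THEN iffD2, OF S] by blast
  then obtain x where x: "x \<noteq> 0" "x \<in> S" "\<And>y. y \<in> span ?E \<Longrightarrow> orthogonal x y"
    using orthogonal_to_subspace_exists_gen[of ?E S] unfolding span_eq_iff[THEN iffD2, OF S] by blast
  define T where "T = S \<inter> {x. \<forall>y \<in> ?E. y \<bullet> x = 0}"
  have "subspace T"
    using S by (auto simp: T_def subspace_def inner_add_right)
  moreover have "f ` T \<subseteq> T"
    using inv by (auto simp: T_def sa)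
  moreover have "T \<noteq> {0}"
    using x by (auto simp: T_def orthogonal_def span_base inner_commute)
  ultimately obtain v c where v: "v \<in> T" "v \<noteq> 0" "f v = c *\<^sub>R v"
    using self_adjoint_eigenvector_exists[OF f sa] by metis
  then have "v \<in> ?E" by (auto simp: T_def)
  with v(1) have "v \<bullet> v = 0" unfolding T_def by blast
  with v(2) show False by simp
qed

section \<open>Linear differential equations with constant coefficients\<close>

text \<open>The solution is the exponential series of \<open>t L\<close> applied to
  \<open>a\<close>. It supplies an actual trajectory from a given pure state, to which the second
  condition of complete decoherence-freeness can be applied.\<close>

lemma linear_ode_solution_exists:
  fixes L :: "'a::euclidean_space \<Rightarrow> 'a"
  assumes L: "linear L"
  obtains u where "u 0 = a" "\<And>t. (u has_vector_derivative L (u t)) (at t)"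
proof -
  have bL: "bounded_linear L" using L by (simp add: linear_conv_bounded_linear)
  obtain K where K: "K > 0" "\<And>x. norm (L x) \<le> norm x * K"
    using bounded_linear.pos_bounded[OF bL] by blast
  define p where "p n = (L ^^ n) a" for n
  have p_bound: "norm (p n) \<le> norm a * K ^ n" for n
  proof (induction n)
    case (Suc n)
    have "norm (p (Suc n)) \<le> norm (p n) * K" using K(2)[of "p n"] by (simp add: p_def)
    also have "\<dots> \<le> norm a * K ^ Suc n" using Suc K(1) by (simp add: mult.assoc mult_right_mono)
    finally show ?case .
  qed (simp add: p_def)
  define u where "u t = (\<Sum>n. (t ^ n / fact n) *\<^sub>R p n)" for t :: real
  have sums: "summable (\<lambda>n. (t ^ n / fact n) *\<^sub>R p n)" for t :: real
  proof (rule summable_comparison_test')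
    show "summable (\<lambda>n. norm a * (inverse (fact n) * (\<bar>t\<bar> * K) ^ n))"
      by (intro summable_mult summable_exp)
    show "norm ((t ^ n / fact n) *\<^sub>R p n) \<le> norm a * (inverse (fact n) * (\<bar>t\<bar> * K) ^ n)"
      if "n \<ge> 0" for n
      using mult_left_mono[OF p_bound[of n], of "\<bar>t\<bar> ^ n / fact n"]
      by (simp add: power_abs power_mult_distrib field_simps)
  qed
  \<comment> \<open>Coordinates turn the vector-valued series into real power series in
    \<open>t\<close>, which can be differentiated term by term.\<close>
  have coord: "u t \<bullet> i = (\<Sum>n. (p n \<bullet> i / fact n) * t ^ n)"
    and coord_summable: "summable (\<lambda>n. (p n \<bullet> i / fact n) * t ^ n)" for t and i :: 'a
    unfolding u_def
    using bounded_linear.suminf[OF bounded_linear_inner_left[of i] sums[of t]]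
      bounded_linear.summable[OF bounded_linear_inner_left[of i] sums[of t]]
    by (simp_all add: mult.commute)
  have Lu: "L (u t) = (\<Sum>n. (t ^ n / fact n) *\<^sub>R p (Suc n))" for t
    unfolding u_def bounded_linear.suminf[OF bL sums] by (simp add: linear_cmul[OF L] p_def)
  have Lsums: "summable (\<lambda>n. (t ^ n / fact n) *\<^sub>R p (Suc n))" for t :: real
    using bounded_linear.summable[OF bL sums] by (simp add: linear_cmul[OF L] p_def)
  have "(u has_vector_derivative L (u t)) (at t)" for t
    unfolding has_vector_derivative_def has_derivative_componentwise_within[of u]
  proof
    fix i :: 'a
    let ?c = "\<lambda>n. p n \<bullet> i / fact n"
    \<comment> \<open>The factor \<open>Suc n\<close> from \<open>diffs\<close> reduces
      \<open>fact (Suc n)\<close> to \<open>fact n\<close>, so the differentiated series is that of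
      \<open>L (u t)\<close>.\<close>
    have "L (u t) \<bullet> i = (\<Sum>n. diffs ?c n * t ^ n)"
      unfolding Lu bounded_linear.suminf[OF bounded_linear_inner_left Lsums]
      by (simp add: diffs_def mult.commute del: of_nat_Suc)
    then have "((\<lambda>t. u t \<bullet> i) has_field_derivative L (u t) \<bullet> i) (at t)"
      using termdiffs_strong_converges_everywhere[of ?c t, OF coord_summable] by (simp add: coord)
    then show "((\<lambda>t. u t \<bullet> i) has_derivative (\<lambda>h. (h *\<^sub>R L (u t)) \<bullet> i)) (at t)"
      unfolding has_field_derivative_def
      by (rule has_derivative_eq_rhs) (simp add: fun_eq_iff mult.commute)
  qed
  moreover have "u 0 = a"
  proof -
    \<comment> \<open>Since \<open>0 ^ 0 = 1\<close>, exactly the term of index 0 survives.\<close>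
    have "u 0 = (\<Sum>n\<in>{0}. (0 ^ n / fact n) *\<^sub>R p n)"
      unfolding u_def by (rule suminf_finite) auto
    then show ?thesis by (simp add: p_def)
  qed
  ultimately show ?thesis using that by blast
qed

text \<open>If \<open>P\<close> projects onto the invariant subspace, then \<open>y = u - P u\<close> satisfies the linear equation
  \<open>y' = (1 - P) L y\<close> with \<open>y 0 = 0\<close>, and Gronwall's inequality gives \<open>y = 0\<close>.\<close>
lemma linear_ode_invariant_subspace:
  fixes L :: "'a::euclidean_space \<Rightarrow> 'a"
  assumes L: "linear L" and X: "subspace X" and inv: "L ` X \<subseteq> X"
    and u: "\<And>t. t \<ge> 0 \<Longrightarrow> (u has_vector_derivative L (u t)) (at t within {0..})"
    and u0: "u 0 \<in> X" and t: "t \<ge> 0"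
  shows "u t \<in> X"
proof -
  \<comment> \<open>A left inverse of the identity on \<open>X\<close> with range in
    \<open>X\<close> is a linear projection onto \<open>X\<close>.\<close>
  have "linear (id :: 'a \<Rightarrow> 'a)" by (simp add: linear_id)
  then obtain P :: "'a \<Rightarrow> 'a" where P: "range P \<subseteq> X" "linear P" "\<And>x. x \<in> X \<Longrightarrow> P x = x"
    using real_vector.linear_exists_left_inverse_on[of id X] X by auto
  define Q where "Q x = x - P x" for x
  have Q: "linear Q"
    unfolding Q_def by (intro linear_compose_sub linear_id[unfolded id_def] P)
  have Q0: "Q x = 0 \<longleftrightarrow> x \<in> X" for x
    using P(1) P(3)[of x] by (auto simp: Q_def)
  \<comment> \<open>\<open>L\<close> maps \<open>P x\<close> into \<open>X\<close>, where
    \<open>Q\<close> vanishes; hence the derivative of \<open>y\<close> depends on \<open>y\<close>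
    alone.\<close>
  have QL: "Q (L x) = Q (L (Q x))" for x
  proof -
    have "L (P x) \<in> X" using P inv by blast
    then show ?thesis
      using Q0[of "L (P x)"] by (simp add: Q_def[of x] linear_diff[OF L] linear_diff[OF Q])
  qed
  have bQL: "bounded_linear (Q \<circ> L)"
    using linear_compose[OF L Q] by (simp add: linear_conv_bounded_linear)
  obtain K where K: "K > 0" "\<And>x. norm ((Q \<circ> L) x) \<le> norm x * K"
    using bounded_linear.pos_bounded[OF bQL] by blast
  define y where "y s = Q (u s)" for s
  have y': "(y has_vector_derivative Q (L (y s))) (at s within {0..})" if "s \<ge> 0" for s
    using bounded_linear.has_vector_derivative[OF Q[unfolded linear_conv_bounded_linear] u[OF that]]
    by (simp add: y_def[abs_def] QL[symmetric])
  \<comment> \<open>The exponential is an integrating factor: \<open>K\<close> bounds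
    \<open>Q\<close> after \<open>L\<close>, so the squared norm of \<open>y\<close> grows at rate
    at most \<open>2 * K\<close> and \<open>g\<close> cannot increase.\<close>
  define g where "g s = exp (- (2 * K * s)) * (y s \<bullet> y s)" for s
  have g': "(g has_real_derivative
      exp (- (2 * K * s)) * (2 * (y s \<bullet> Q (L (y s))) - 2 * K * (y s \<bullet> y s))) (at s within {0..})"
    if "s \<ge> 0" for s
  proof -
    have "((\<lambda>s. y s \<bullet> y s) has_real_derivative 2 * (y s \<bullet> Q (L (y s)))) (at s within {0..})"
      using bounded_bilinear.has_vector_derivative[OF bounded_bilinear_inner y'[OF that] y'[OF that]]
      by (simp add: has_real_derivative_iff_has_vector_derivative inner_commute)
    then show ?thesis
      unfolding g_def by (auto intro!: derivative_eq_intros simp: algebra_simps)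
  qed
  have "g t \<le> g 0"
  \<comment> \<open>At 0 the derivative is known from the right only, so monotonicity comes from the
    open interval together with continuity up to the endpoints.\<close>
  proof (rule DERIV_nonpos_imp_decreasing_open[OF t])
    fix s :: real assume s: "0 < s" "s < t"
    have "y s \<bullet> Q (L (y s)) \<le> norm (y s) * norm (Q (L (y s)))" by (rule norm_cauchy_schwarz)
    also have "\<dots> \<le> norm (y s) * (norm (y s) * K)"
      using K(2)[of "y s"] by (intro mult_left_mono) auto
    also have "\<dots> = K * (y s \<bullet> y s)" by (simp add: dot_square_norm power2_eq_square)
    finally have "2 * (y s \<bullet> Q (L (y s))) - 2 * K * (y s \<bullet> y s) \<le> 0" by simp
    moreover have "at s within {0..} = at s"
      using s by (intro at_within_interior) simp
    ultimately show "\<exists>d. DERIV g s :> d \<and> d \<le> 0"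
      using g'[of s] s by (intro exI conjI) (auto simp: mult_nonneg_nonpos)
  next
    show "continuous_on {0..t} g"
      by (rule continuous_on_subset[of "{0..}"])
        (auto simp: continuous_on_eq_continuous_within intro: DERIV_continuous g')
  qed
  also have "g 0 = 0" using u0 Q0 by (simp add: g_def y_def)
  finally have "y t \<bullet> y t \<le> 0"
    by (simp add: g_def mult_le_0_iff)
  then have "y t = 0"
    using inner_ge_zero[of "y t"] inner_eq_zero_iff[of "y t"] by linarith
  then show ?thesis by (simp add: y_def Q0)
qed

section \<open>Adjoints, scalar matrices and the sesquilinear product\<close>

lemma dagger_matrix_mult: "dagger (A ** B) = dagger B ** dagger A"
  by (simp add: dagger_def matrix_matrix_mult_def vec_eq_iff mult.commute)

lemma dagger_add: "dagger (A + B) = dagger A + dagger B"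
  and dagger_diff: "dagger (A - B) = dagger A - dagger B"
  and dagger_scaleR: "dagger (r *\<^sub>R A) = r *\<^sub>R dagger A"
  and dagger_zero [simp]: "dagger 0 = 0"
  by (simp_all add: dagger_def vec_eq_iff)

lemma dagger_sum: "dagger (\<Sum>x\<in>X. A x) = (\<Sum>x\<in>X. dagger (A x))"
  by (simp add: dagger_def vec_eq_iff)

lemma dagger_mat: "dagger (mat c) = mat (cnj c)"
  by (auto simp: dagger_def mat_def vec_eq_iff)

lemma mat_matrix_mult_component: "(mat c ** A) $ i $ j = c * A $ i $ j"
  and matrix_mult_mat_component: "(A ** mat c) $ i $ j = A $ i $ j * c"
  for c :: "'a::comm_semiring_1" and A :: "'a^'n^'n"
  by (simp_all add: matrix_matrix_mult_def mat_def if_distrib if_distribR cong: if_cong)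

lemma mat_matrix_mult_commute: "mat c ** A = A ** mat c"
  for c :: "'a::comm_semiring_1" and A :: "'a^'n^'n"
  by (simp add: vec_eq_iff mat_matrix_mult_component matrix_mult_mat_component mult.commute)

lemma mat_vector_mult: "mat c *v x = c *s x" for c :: "'a::comm_semiring_1"
  by (simp add: vec_eq_iff matrix_vector_mult_def mat_def if_distrib if_distribR cong: if_cong)

lemma scaleR_eq_scalar_mult: "r *\<^sub>R x = of_real r *s x" for x :: "complex^'n"
  by (simp add: vec_eq_iff scaleR_conv_of_real[where 'a = complex])

text \<open>\<open>vec.subspace\<close> is the complex notion and \<open>subspace\<close> the real
  one; the eigenvector, closedness and differential equation results are stated for the
  latter.\<close>

lemma vec_subspace_imp_subspace: "vec.subspace S \<Longrightarrow> subspace S" for S :: "(complex^'n) set"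
  by (simp add: subspace_def vec.subspace_def scaleR_eq_scalar_mult)

lemma scaleR_matrix_mult_left: "(r *\<^sub>R A) ** B = r *\<^sub>R (A ** B)"
  and scaleR_matrix_mult_right: "A ** (r *\<^sub>R B) = r *\<^sub>R (A ** B)"
  for A :: "complex^'n^'m" and B :: "complex^'k^'n"
  by (simp_all add: matrix_matrix_mult_def vec_eq_iff scaleR_sum_right)

lemma matrix_mult_add_left: "(A + B) ** C = A ** C + B ** C"
  and matrix_mult_diff_left: "(A - B) ** C = A ** C - B ** C"
  and matrix_mult_diff_right: "D ** (A - B) = D ** A - D ** B"
  for A B :: "complex^'n^'m"
  by (simp_all add: matrix_matrix_mult_def vec_eq_iff algebra_simps sum.distrib sum_subtractf)

lemma linear_matrix_vector_mult: "linear ((*v) A)" for A :: "complex^'n^'m"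
  by (rule linearI)
    (simp_all add: matrix_vector_right_distrib scaleR_eq_scalar_mult vector_scalar_commute)

lemma linear_master_generator: "linear (master_generator H J lam)"
  by (rule linearI)
    (simp_all add: master_generator_def commutator_def dissipator_def matrix_add_ldistrib
      matrix_mult_add_left matrix_mult_diff_left matrix_mult_diff_right
      scaleR_matrix_mult_left scaleR_matrix_mult_right algebra_simps)

lemma inner_eq_Re_cinner: "x \<bullet> y = Re (cinner x y)"
  by (simp add: inner_vec_def cinner_def inner_complex_def)

lemma cinner_self: "cinner x x = of_real (x \<bullet> x)"
  by (simp add: inner_vec_def cinner_def inner_complex_def complex_eq_iff power2_eq_square mult.commute)

lemma cinner_matrix_vector_mult: "cinner x (A *v y) = cinner (dagger A *v x) y"
proof -
  have "cinner x (A *v y) = (\<Sum>i\<in>UNIV. \<Sum>j\<in>UNIV. cnj (x $ i) * (A $ i $ j * y $ j))"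
    by (simp add: cinner_def matrix_vector_mult_def sum_distrib_left)
  also have "\<dots> = (\<Sum>j\<in>UNIV. \<Sum>i\<in>UNIV. cnj (x $ i) * (A $ i $ j * y $ j))"
    by (rule sum.swap)
  also have "\<dots> = cinner (dagger A *v x) y"
    by (simp add: cinner_def matrix_vector_mult_def dagger_def sum_distrib_left sum_distrib_right mult_ac)
  finally show ?thesis .
qed

text \<open>The real inner product is the real part of \<open>cinner\<close>, so the spectral
  argument over the reals applies to Hermitian matrices.\<close>

lemma hermitian_self_adjoint: "hermitian H \<Longrightarrow> x \<bullet> (H *v y) = (H *v x) \<bullet> y"
  by (simp add: inner_eq_Re_cinner cinner_matrix_vector_mult hermitian_def)

lemma outer_vector_mult: "outer v w *v x = cinner w x *s v"
  by (simp add: outer_def matrix_vector_mult_def cinner_def vec_eq_iff sum_distrib_left sum_distrib_right mult_ac)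

section \<open>Pure states, supports and the dissipator\<close>

lemma density_operator_outer:
  assumes "norm w = 1"
  shows "density_operator (outer w w)"
proof -
  have w: "cinner w w = 1" using assms by (simp add: cinner_self norm_eq_1)
  have "cinner v (outer w w *v v) = of_real ((cmod (cinner w v))\<^sup>2)" for v
  proof -
    have "cinner v w = cnj (cinner w v)" by (simp add: cinner_def mult.commute)
    moreover have "cinner v (c *s w) = c * cinner v w" for c
      by (simp add: cinner_def sum_distrib_left mult_ac)
    ultimately show ?thesis
      by (simp add: outer_vector_mult complex_norm_square del: of_real_power)
  qed
  then have "0 \<le> Re (cinner v (outer w w *v v))" for v by (simp del: of_real_power)
  moreover have "hermitian (outer w w)"
    by (simp add: hermitian_def dagger_def outer_def vec_eq_iff mult.commute)
  moreover have "trace (outer w w) = 1"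
    using w by (simp add: trace_def outer_def cinner_def mult.commute)
  ultimately show ?thesis by (simp add: density_operator_def)
qed

lemma supported_on_iff: "supported_on A W \<longleftrightarrow> (\<forall>x. A *v x \<in> W)"
  by (auto simp: supported_on_def)

lemma subspace_supported_on:
  assumes "vec.subspace W"
  shows "subspace {A. supported_on A W}"
proof -
  have "(r *\<^sub>R A) *v x = r *\<^sub>R (A *v x)" for r and A :: "complex^'a^'a" and x
    by (simp add: matrix_vector_mult_def vec_eq_iff scaleR_sum_right)
  then show ?thesis
    using vec_subspace_imp_subspace[OF assms]
    by (simp add: subspace_def supported_on_iff matrix_vector_mult_add_rdistrib)
qed

text \<open>The range of \<rho> lies in the kernel of \<open>J\<close>, so \<open>J\<close>
  annihilates \<rho> from the left; taking adjoints, \<open>dagger J\<close> annihilates it from the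
  right. Each of the three terms contains one of these two products.\<close>

lemma dissipator_eq_zero:
  assumes "W \<subseteq> {v. J *v v = 0}" "hermitian \<rho>" "supported_on \<rho> W"
  shows "dissipator lam J \<rho> = 0"
proof -
  have "(J ** \<rho>) *v x = 0 *v x" for x
    using assms(1,3) by (auto simp: supported_on_iff matrix_vector_mul_assoc[symmetric])
  then have J: "J ** \<rho> = 0" by (simp add: matrix_eq)
  then have "\<rho> ** dagger J = 0"
    using dagger_matrix_mult[of J \<rho>] assms(2) by (simp add: hermitian_def)
  with J show ?thesis
    by (simp add: dissipator_def matrix_mul_assoc[symmetric, of "dagger J" J \<rho>])
qed

section \<open>Complete decoherence-freeness and invariance under the Hamiltonian\<close>

text \<open>To the right of \<open>a\<close> the norm of \<open>t - a\<close> is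
  \<open>t - a\<close> itself, so the normalised remainder is the difference quotient minus
  \<open>D\<close>. In this form a derivative is a limit that closed sets retain.\<close>

lemma has_vector_derivative_at_right_iff:
  "(u has_vector_derivative D) (at_right a)
    \<longleftrightarrow> ((\<lambda>t. (u t - u a) /\<^sub>R (t - a)) \<longlongrightarrow> D) (at_right a)"
proof -
  have "(u has_vector_derivative D) (at_right a)
      \<longleftrightarrow> ((\<lambda>t. (1 / norm (t - a)) *\<^sub>R (u t - (u a + (t - a) *\<^sub>R D))) \<longlongrightarrow> 0) (at_right a)"
    by (simp add: has_vector_derivative_def has_derivative_within bounded_linear_scaleR_left)
  also have "\<dots> \<longleftrightarrow> ((\<lambda>t. (u t - u a) /\<^sub>R (t - a) - D) \<longlongrightarrow> 0) (at_right a)"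
    by (intro tendsto_cong)
      (auto simp: eventually_at_filter diff_diff_add[symmetric] scaleR_right_diff_distrib
        divide_inverse intro!: always_eventually)
  finally show ?thesis by (simp add: LIM_zero_iff)
qed

lemma completely_decoherence_free_iff_invariant:
  fixes H J :: "complex^'n^'n"
  assumes W: "vec.subspace W" and ker: "W \<subseteq> {v. J *v v = 0}" and H: "hermitian H"
  shows "completely_decoherence_free H J lam W \<longleftrightarrow> (*v) H ` W \<subseteq> W"
proof
  assume cdf: "completely_decoherence_free H J lam W"
  \<comment> \<open>Unit vectors come first because \<open>outer w w\<close> has trace 1 just for
    these; other vectors follow by scaling.\<close>
  have unit: "H *v w \<in> W" if w: "w \<in> W" "norm w = 1" for w
  proof -
    let ?\<rho>0 = "outer w w"
    have supp: "supported_on ?\<rho>0 W"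
      using w(1) W by (simp add: supported_on_iff outer_vector_mult vec.subspace_scale)
    have dens: "density_operator ?\<rho>0" using w(2) by (rule density_operator_outer)
    obtain u where u0: "u 0 = ?\<rho>0"
      and u: "\<And>t. (u has_vector_derivative master_generator H J lam (u t)) (at t)"
      using linear_ode_solution_exists[OF linear_master_generator] by blast
    have "master_solution H J lam u"
      using u by (simp add: master_solution_def has_vector_derivative_at_within)
    then have ut: "supported_on (u t) W" if "t \<ge> 0" for t
      using cdf supp dens that u0 unfolding completely_decoherence_free_def by metis
    let ?X = "{A. supported_on A W}"
    note X = subspace_supported_on[OF W]
    \<comment> \<open>The support of \<open>u t\<close> is controlled for nonnegative times, so the
      difference quotients are taken from the right. They lie in a subspace of a finite-dimensional
      space, which is closed.\<close>
    have "master_generator H J lam ?\<rho>0 \<in> ?X"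
    proof (rule Lim_in_closed_set[OF closed_subspace[OF X]])
      show "((\<lambda>t. (u t - u 0) /\<^sub>R t) \<longlongrightarrow> master_generator H J lam ?\<rho>0) (at_right 0)"
        using has_vector_derivative_at_within[OF u[of 0], of "{0<..}"] u0
        by (simp add: has_vector_derivative_at_right_iff)
      show "\<forall>\<^sub>F t in at_right 0. (u t - u 0) /\<^sub>R t \<in> ?X"
        using ut subspace_diff[OF X] subspace_scale[OF X]
        by (auto simp: eventually_at_filter)
    qed simp
    moreover have "dissipator lam J ?\<rho>0 = 0"
      using dissipator_eq_zero[OF ker _ supp] dens by (simp add: density_operator_def)
    ultimately have "(mat (- \<i>) ** commutator H ?\<rho>0) *v w \<in> W"
      by (simp add: master_generator_def supported_on_iff)
    moreover have "cinner w w = 1" using w(2) by (simp add: cinner_self norm_eq_1)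
    ultimately have "(- \<i>) *s (H *v w - cinner w (H *v w) *s w) \<in> W"
      by (simp add: commutator_def matrix_vector_mul_assoc[symmetric] mat_vector_mult
          matrix_vector_mult_diff_rdistrib outer_vector_mult)
    from vec.subspace_scale[OF W this, of \<i>] have "H *v w - cinner w (H *v w) *s w \<in> W"
      by simp
    from vec.subspace_add[OF W this vec.subspace_scale[OF W w(1)]] show ?thesis
      by (metis diff_add_cancel)
  qed
  show "(*v) H ` W \<subseteq> W"
  proof clarify
    fix w assume w: "w \<in> W"
    note S = vec_subspace_imp_subspace[OF W]
    interpret linear "(*v) H" by (rule linear_matrix_vector_mult)
    show "H *v w \<in> W"
    proof (cases "w = 0")
      case False
      then have "H *v (w /\<^sub>R norm w) \<in> W"
        using w subspace_scale[OF S] by (intro unit) auto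
      from subspace_scale[OF S this, of "norm w"] show ?thesis
        using False by (simp add: scaleR)
    qed (use w in simp)
  qed
next
  assume inv: "(*v) H ` W \<subseteq> W"
  have supp: "supported_on (\<rho> t) W"
    if sol: "master_solution H J lam \<rho>" and dens: "density_operator (\<rho> 0)"
      and supp0: "supported_on (\<rho> 0) W" and t: "t \<ge> 0" for \<rho> t
  proof -
    \<comment> \<open>Hermiticity belongs to the invariant space because the vanishing of the
      dissipator relies on it; this makes \<open>?X\<close> a real subspace.\<close>
    let ?X = "{A. supported_on A W} \<inter> {A. hermitian A}"
    have "subspace {A :: complex^'n^'n. hermitian A}"
      by (simp add: subspace_def hermitian_def dagger_add dagger_scaleR)
    then have "subspace ?X"
      by (intro subspace_inter subspace_supported_on W)
    moreover have "master_generator H J lam ` ?X \<subseteq> ?X"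
    proof clarify
      fix A assume A: "supported_on A W" "hermitian A"
      have gen: "master_generator H J lam A = mat (- \<i>) ** (H ** A - A ** H)"
        using dissipator_eq_zero[OF ker A(2,1)] by (simp add: master_generator_def commutator_def)
      \<comment> \<open>Taking adjoints flips the sign of both the scalar and the commutator of two
        Hermitian matrices, so their product is Hermitian.\<close>
      have "dagger (mat (- \<i>) ** (H ** A - A ** H)) = (A ** H - H ** A) ** mat \<i>"
        using A H by (simp add: dagger_matrix_mult dagger_diff dagger_mat hermitian_def)
      also have "\<dots> = mat (- \<i>) ** (H ** A - A ** H)"
        by (simp add: vec_eq_iff mat_matrix_mult_component matrix_mult_mat_component algebra_simps)
      finally have "hermitian (master_generator H J lam A)"
        by (simp add: gen hermitian_def)
      moreover have "supported_on (master_generator H J lam A) W"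
        using A inv W
        by (auto simp: gen supported_on_iff matrix_vector_mul_assoc[symmetric] mat_vector_mult
            matrix_vector_mult_diff_rdistrib image_subset_iff
            intro!: vec.subspace_scale vec.subspace_diff)
      ultimately show "master_generator H J lam A \<in> ?X" by simp
    qed
    moreover have "(\<rho> has_vector_derivative master_generator H J lam (\<rho> s)) (at s within {0..})"
      if "s \<ge> 0" for s
      using sol that by (simp add: master_solution_def)
    moreover have "\<rho> 0 \<in> ?X"
      using dens supp0 by (simp add: density_operator_def)
    ultimately have "\<rho> t \<in> ?X"
      using t by (rule linear_ode_invariant_subspace[OF linear_master_generator])
    then show ?thesis by simp
  qed
  show "completely_decoherence_free H J lam W"
    unfolding completely_decoherence_free_def
    using dissipator_eq_zero[OF ker] supp by (auto simp: density_operator_def)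
qed

section \<open>Eigenbases of invariant complex subspaces\<close>

text \<open>Eigenvectors with real eigenvalues already span \<open>W\<close> over the reals, hence
  over the complex numbers. A maximal complex-independent set of them is therefore a basis.\<close>

lemma hermitian_invariant_subspace_eigenbasis:
  fixes H :: "complex^'n^'n"
  assumes H: "hermitian H" and W: "vec.subspace W" and inv: "(*v) H ` W \<subseteq> W"
  shows "\<exists>B\<subseteq>W. vec.independent B \<and> vec.span B = W \<and> (\<forall>v\<in>B. eigenvector H v)"
proof -
  define E where "E = {v \<in> W. v \<noteq> 0 \<and> (\<exists>c. H *v v = c *\<^sub>R v)}"
  have eig: "eigenvector H v" if "v \<in> E" for v
    using that by (auto simp: E_def eigenvector_def scaleR_eq_scalar_mult)
  obtain B where B: "B \<subseteq> E" "vec.independent B" "E \<subseteq> vec.span B"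
    using vec.maximal_independent_subset[of E] by blast
  have "span E = W"
    unfolding E_def using H inv
    by (intro self_adjoint_span_eigenvectors linear_matrix_vector_mult hermitian_self_adjoint
        vec_subspace_imp_subspace W)
  moreover have "span E \<subseteq> vec.span B"
    using B(3) by (intro span_minimal vec_subspace_imp_subspace vec.subspace_span)
  moreover have "vec.span B \<subseteq> W"
    using B(1) W by (intro vec.span_minimal) (auto simp: E_def)
  ultimately have "vec.span B = W" by blast
  moreover have "B \<subseteq> W" using B(1) by (auto simp: E_def)
  ultimately show ?thesis using B eig by blast
qed

section \<open>The exchange Hamiltonian on qubits\<close>

lemma dagger_on_site: "dagger (on_site i A) = on_site i (dagger A)"
proof -
  have "dagger (tensor_op B) = tensor_op (\<lambda>j. dagger (B j))" for B :: "'a::finite \<Rightarrow> complex^bool^bool"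
    by (simp add: dagger_def tensor_op_def vec_eq_iff)
  then show ?thesis
    by (simp add: on_site_def if_distrib[of dagger] dagger_mat cong: if_cong)
qed

lemma dagger_outer: "dagger (outer v w) = outer w v"
  by (simp add: dagger_def outer_def vec_eq_iff mult.commute)

text \<open>The adjoint reverses each product, exchanges \<open>sigma_plus\<close> with
  \<open>sigma_minus\<close> and conjugates the coefficient, so it carries the term of (\<alpha>,
  \<beta>) to that of (\<beta>, \<alpha>). Swapping the two sums restores the Hamiltonian.\<close>

lemma hermitian_exchange_hamiltonian:
  assumes "hermitian b"
  shows "hermitian (exchange_hamiltonian b)"
proof -
  have b: "cnj (b $ \<alpha> $ \<beta>) = b $ \<beta> $ \<alpha>" for \<alpha> \<beta>
    using assms by (metis (no_types, lifting) hermitian_def dagger_def vec_lambda_beta)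
  have "dagger (exchange_hamiltonian b) = (\<Sum>\<alpha>\<in>UNIV. \<Sum>\<beta>\<in>UNIV.
      mat (b $ \<beta> $ \<alpha>) ** (on_site \<beta> sigma_plus ** on_site \<alpha> sigma_minus))"
    by (simp add: exchange_hamiltonian_def dagger_sum dagger_matrix_mult dagger_mat dagger_on_site b
        sigma_plus_def sigma_minus_def dagger_outer mat_matrix_mult_commute)
  also have "\<dots> = exchange_hamiltonian b"
    unfolding exchange_hamiltonian_def by (rule sum.swap)
  finally show ?thesis by (simp add: hermitian_def)
qed

theorem proposition1:
  fixes b :: "complex^'n^'n" and lam :: real and W :: "'n::finite qubits set"
  assumes "lam > 0"
    and "hermitian b"
    and "vec.subspace W"
    and "W \<subseteq> lowest_weight_space"
  shows "(completely_decoherence_free (exchange_hamiltonian b) collective_lowering lam W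
            \<longleftrightarrow> (*v) (exchange_hamiltonian b) ` W \<subseteq> W)
       \<and> (completely_decoherence_free (exchange_hamiltonian b) collective_lowering lam W
            \<longrightarrow> (\<exists>B\<subseteq>W. vec.independent B \<and> vec.span B = W \<and>
                  (\<forall>v\<in>B. eigenvector (exchange_hamiltonian b) v)))"
proof -
  have H: "hermitian (exchange_hamiltonian b)"
    using assms(2) by (rule hermitian_exchange_hamiltonian)
  have "completely_decoherence_free (exchange_hamiltonian b) collective_lowering lam W
      \<longleftrightarrow> (*v) (exchange_hamiltonian b) ` W \<subseteq> W"
    using completely_decoherence_free_iff_invariant[OF assms(3) _ H] assms(4)
    by (simp add: lowest_weight_space_def)
  then show ?thesis
    using hermitian_invariant_subspace_eigenbasis[OF H assms(3)] by blast
qed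

end
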